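(* Let $n,k$ be positive integers and let $\sigma\in\mathfrak{S}_n$ have cycle type $(c_1,\dots,c_n)$, where $c_\ell$ is the number of cycles of length $\ell$ in $\sigma$. Then the number of fixed points of $\sigma^{\odot k}$ is $$\operatorname{Fix}(\sigma^{\odot k})=\sum_{s_1+2s_2+\cdots+ns_n=k}\ \prod_{\ell=1}^n\binom{s_\ell+c_\ell-1}{s_\ell},$$ where the sum runs over all sequences $(s_1,\dots,s_n)$ of non-negative integers with $s_1+2s_2+\cdots+ns_n=k$.
   Context: For positive integers $n,k$, let $\mathcal{C}_{n,k}$ be the set of weakly increasing $k$-tuples $(i_1\le\cdots\le i_k)$ with entries in $[n]$ (equivalently, $k$-element multisets from $[n]$). For $\sigma\in\mathfrak{S}_n$, the $k$-th symmetric tensor power $\sigma^{\odot k}$ is the permutation of $\mathcal{C}_{n,k}$ sending $(i_1,\dots,i_k)$ to the weakly increasing rearrangement of $(\sigma(i_1),\dots,\sigma(i_k))$ (equivalently, the permutation given by the $k$-th symmetric tensor power of the permutation matrix of $\sigma$). $\operatorname{Fix}(\tau)$ is the number of fixed points of $\tau$. Binomial coefficients $\binom{a}{b}$ with integer $a$ and nonnegative integer $b$ are $a(a-1)\cdots(a-b+1)/b!$ (so $\binom{-1}{0}=1$ and $\binom{m-1}{m}=0$ for $m\ge1$). *)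

theory Defs
  imports Complex_Main "HOL-Library.FuncSet" "HOL-Library.Multiset" "HOL-Combinatorics.Permutations"
    "HOL-Combinatorics.Orbits"
begin

definition weakly_increasing_tuples :: "nat \<Rightarrow> nat \<Rightarrow> nat list set" where
  "weakly_increasing_tuples n k = {xs. length xs = k \<and> sorted xs \<and> set xs \<subseteq> {1..n}}"

text \<open>
  The symmetric tensor power follows the convention of \<open>permutes\<close>: it is the identity
  outside of the tuples on which it acts.
\<close>
definition sym_tensor_power :: "nat \<Rightarrow> nat \<Rightarrow> (nat \<Rightarrow> nat) \<Rightarrow> nat list \<Rightarrow> nat list" where
  "sym_tensor_power n k \<sigma> xs =
     (if xs \<in> weakly_increasing_tuples n k then sort (map \<sigma> xs) else xs)"

definition num_fixed_points :: "'a set \<Rightarrow> ('a \<Rightarrow> 'a) \<Rightarrow> nat" where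
  "num_fixed_points A \<tau> = card {x \<in> A. \<tau> x = x}"

text \<open>
  Cycles are identified with their underlying sets, the orbits; fixed points count as
  cycles of length 1.
\<close>
definition num_cycles :: "'a set \<Rightarrow> ('a \<Rightarrow> 'a) \<Rightarrow> nat \<Rightarrow> nat" where
  "num_cycles A \<sigma> l = card {C \<in> orbit \<sigma> ` A. card C = l}"

text \<open>
  Sequences \<open>s\<^sub>1, \<dots>, s\<^sub>n\<close> are extensional functions on \<open>{1..n}\<close>, so that each sequence
  is represented exactly once.
\<close>
definition weighted_sequences :: "nat \<Rightarrow> nat \<Rightarrow> (nat \<Rightarrow> nat) set" where
  "weighted_sequences n k = {s \<in> {1..n} \<rightarrow>\<^sub>E UNIV. (\<Sum>l=1..n. l * s l) = k}"

lemma finite_weakly_increasing_tuples: "finite (weakly_increasing_tuples n k)"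
proof (rule finite_subset)
  show "weakly_increasing_tuples n k \<subseteq> {xs. set xs \<subseteq> {1..n} \<and> length xs = k}"
    by (auto simp: weakly_increasing_tuples_def)
qed (simp add: finite_lists_length_eq)

lemma finite_weighted_sequences: "finite (weighted_sequences n k)"
proof (rule finite_subset)
  show "weighted_sequences n k \<subseteq> {1..n} \<rightarrow>\<^sub>E {..k}"
  proof
    fix s assume s: "s \<in> weighted_sequences n k"
    have "s l \<le> k" if l: "l \<in> {1..n}" for l
    proof -
      have "s l \<le> l * s l" using l by simp
      also have "\<dots> \<le> (\<Sum>l=1..n. l * s l)"
        using l by (intro member_le_sum) auto
      finally show ?thesis using s by (simp add: weighted_sequences_def)
    qed
    then show "s \<in> {1..n} \<rightarrow>\<^sub>E {..k}"
      using s by (auto simp: weighted_sequences_def PiE_iff)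
  qed
qed (simp add: finite_PiE)

lemma sym_tensor_power_permutes:
  assumes "\<sigma> permutes {1..n}"
  shows "sym_tensor_power n k \<sigma> permutes weakly_increasing_tuples n k"
proof (rule inj_imp_permutes)
  show "inj_on (sym_tensor_power n k \<sigma>) (weakly_increasing_tuples n k)"
  proof (rule inj_onI)
    fix xs ys
    assume xs: "xs \<in> weakly_increasing_tuples n k" and ys: "ys \<in> weakly_increasing_tuples n k"
      and "sym_tensor_power n k \<sigma> xs = sym_tensor_power n k \<sigma> ys"
    then have "sort (map \<sigma> xs) = sort (map \<sigma> ys)"
      by (simp add: sym_tensor_power_def)
    then have "image_mset \<sigma> (mset xs) = image_mset \<sigma> (mset ys)"
      by (metis mset_map mset_sort)
    moreover have "inj \<sigma>" using assms by (rule permutes_inj)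
    ultimately have "mset xs = mset ys"
      by (metis multiset.inj_map injD)
    then show "xs = ys"
      using xs ys by (metis (mono_tags, lifting) mem_Collect_eq properties_for_sort
        sorted_sort_id weakly_increasing_tuples_def)
  qed
next
  fix xs assume "xs \<in> weakly_increasing_tuples n k"
  then show "sym_tensor_power n k \<sigma> xs \<in> weakly_increasing_tuples n k"
    using permutes_in_image[OF assms]
    by (auto simp: weakly_increasing_tuples_def sym_tensor_power_def)
next
  fix xs assume "xs \<notin> weakly_increasing_tuples n k"
  then show "sym_tensor_power n k \<sigma> xs = xs"
    by (simp add: sym_tensor_power_def)
qed (rule finite_weakly_increasing_tuples)

end

theory Submission
  imports Defs
begin

text \<open>
  A weakly increasing tuple is a multiset, and it is fixed by \<open>\<sigma>\<^sup>\<odot>\<^sup>k\<close> iff its multiplicities are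
  constant on the cycles of \<open>\<sigma>\<close>. Fixed points therefore correspond to assignments \<open>m\<close> of a
  multiplicity to each cycle with \<open>\<Sum>C. card C * m C = k\<close>. Sorting these by the total multiplicity
  \<open>s\<^sub>l\<close> given to the cycles of length \<open>l\<close>, stars and bars counts the distributions of \<open>s\<^sub>l\<close> among the
  \<open>c\<^sub>l\<close> cycles independently for each \<open>l\<close>.
\<close>

section \<open>Counting functions with a prescribed sum (stars and bars)\<close>

lemma finite_PiE_sum_eq:
  fixes N :: nat
  assumes "finite A"
  shows "finite {f \<in> A \<rightarrow>\<^sub>E UNIV. sum f A = N}"
proof (rule finite_subset)
  show "{f \<in> A \<rightarrow>\<^sub>E UNIV. sum f A = N} \<subseteq> A \<rightarrow>\<^sub>E {..N}"
    using member_le_sum[of _ A] assms by (fastforce simp: PiE_iff)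
qed (simp add: assms finite_PiE)

text \<open>Stars and bars by induction on \<open>A\<close>: if the values on \<open>A\<close> sum
  to \<open>j\<close>, the new element must receive \<open>N - j\<close>, so the counts for
  \<open>A\<close> are summed over \<open>j \<le> N\<close>, and the parallel summation identity
  closes the step.\<close>

lemma card_PiE_sum_eq_gbinomial:
  fixes N :: nat
  assumes "finite A"
  shows "real (card {f \<in> A \<rightarrow>\<^sub>E UNIV. sum f A = N}) = (real N + real (card A) - 1) gchoose N"
  using assms
proof (induction A arbitrary: N rule: finite_induct)
  case empty
  have "{f \<in> {} \<rightarrow>\<^sub>E UNIV. sum f {} = N} = (if N = 0 then {\<lambda>_. undefined} else {})"
    by auto
  then have "card {f \<in> {} \<rightarrow>\<^sub>E (UNIV :: nat set). sum f ({} :: 'a set) = N} = (if N = 0 then 1 else 0)"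
    by (cases "N = 0") simp_all
  \<comment> \<open>For \<open>N = 0\<close> the upper index is -1 and the value is 1; for positive
    \<open>N\<close> it is \<open>N - 1\<close> over \<open>N\<close>, hence 0. This later covers
    lengths that no cycle has.\<close>
  also have "real \<dots> = (real N - 1) gchoose N"
    by (cases N) (simp_all add: binomial_gbinomial[symmetric])
  finally show ?case by simp
next
  case (insert a A)
  let ?S = "\<lambda>B N. {f \<in> B \<rightarrow>\<^sub>E (UNIV :: nat set). sum f B = N}"
  have "bij_betw (\<lambda>(j, f). f(a := N - j)) (SIGMA j:{..N}. ?S A j) (?S (insert a A) N)"
  proof (rule bij_betw_byWitness[where f' = "\<lambda>f. (sum f A, restrict f A)"])
    \<comment> \<open>As \<open>a \<notin> A\<close>, the new value does not affect the sum; the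
      \<open>if\<close> is the unfolded form of \<open>f(a := x)\<close>.\<close>
    have upd: "(\<Sum>y\<in>A. if y = a then x else f y) = sum f A" for f :: "'a \<Rightarrow> nat" and x
      using insert.hyps by (intro sum.cong) auto
    show "\<forall>p\<in>SIGMA j:{..N}. ?S A j. (\<lambda>f. (sum f A, restrict f A)) ((\<lambda>(j, f). f(a := N - j)) p) = p"
      using insert.hyps by (auto simp: upd fun_eq_iff PiE_iff extensional_def)
    show "\<forall>f\<in>?S (insert a A) N. (\<lambda>(j, f). f(a := N - j)) (sum f A, restrict f A) = f"
      using insert.hyps by (auto simp: fun_eq_iff PiE_iff extensional_def)
    show "(\<lambda>(j, f). f(a := N - j)) ` (SIGMA j:{..N}. ?S A j) \<subseteq> ?S (insert a A) N"
      using insert.hyps by (auto simp: upd PiE_iff extensional_def)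
    show "(\<lambda>f. (sum f A, restrict f A)) ` ?S (insert a A) N \<subseteq> (SIGMA j:{..N}. ?S A j)"
      using insert.hyps by auto
  qed
  then have "card (?S (insert a A) N) = (\<Sum>j\<le>N. card (?S A j))"
    using insert.hyps by (simp add: bij_betw_same_card[symmetric] card_SigmaI finite_PiE_sum_eq)
  then have "real (card (?S (insert a A) N)) = (\<Sum>j\<le>N. (real (card A) - 1 + real j) gchoose j)"
    by (simp add: insert.IH algebra_simps)
  also have "\<dots> = (real (card A) - 1 + real N + 1) gchoose N"
    by (rule gbinomial_parallel_sum)
  finally show ?case
    using insert.hyps by (simp add: algebra_simps)
qed

section \<open>Splitting multiplicity functions by weight\<close>

text \<open>The fibres of \<open>w\<close> over \<open>L\<close> partition \<open>P\<close> and each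
  constraint involves one fibre only, so the choices on different fibres are independent. Empty
  fibres are allowed.\<close>

lemma card_PiE_fibre_sums:
  fixes w :: "'a \<Rightarrow> 'b" and s :: "'b \<Rightarrow> nat"
  assumes "finite P" and "finite L" and "w ` P \<subseteq> L"
  shows "card {m \<in> P \<rightarrow>\<^sub>E UNIV. \<forall>l\<in>L. sum m {x \<in> P. w x = l} = s l} =
    (\<Prod>l\<in>L. card {f \<in> {x \<in> P. w x = l} \<rightarrow>\<^sub>E UNIV. sum f {x \<in> P. w x = l} = s l})"
    (is "card ?M = (\<Prod>l\<in>L. card (?F l))")
proof -
  have "bij_betw (\<lambda>m. \<lambda>l\<in>L. restrict m {x \<in> P. w x = l}) ?M (Pi\<^sub>E L ?F)"
  \<comment> \<open>The inverse glues a family together: at \<open>x\<close> it consults the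
    component of the fibre that contains \<open>x\<close>.\<close>
  proof (rule bij_betw_byWitness[where f' = "\<lambda>g. \<lambda>x\<in>P. g (w x) x"])
    show "\<forall>m\<in>?M. (\<lambda>x\<in>P. (\<lambda>l\<in>L. restrict m {x \<in> P. w x = l}) (w x) x) = m"
      using assms(3) by (auto simp: fun_eq_iff PiE_iff extensional_def)
    show "\<forall>g\<in>Pi\<^sub>E L ?F. (\<lambda>l\<in>L. restrict (\<lambda>x\<in>P. g (w x) x) {x \<in> P. w x = l}) = g"
      using assms(3) by (fastforce simp: fun_eq_iff PiE_iff extensional_def)
    show "(\<lambda>m. \<lambda>l\<in>L. restrict m {x \<in> P. w x = l}) ` ?M \<subseteq> Pi\<^sub>E L ?F"
      by (auto split: if_splits)
    show "(\<lambda>g. \<lambda>x\<in>P. g (w x) x) ` Pi\<^sub>E L ?F \<subseteq> ?M"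
      by (auto simp: PiE_iff)
  qed
  then have "card ?M = card (Pi\<^sub>E L ?F)"
    by (rule bij_betw_same_card)
  then show ?thesis
    using assms(2) by (simp add: card_PiE)
qed

text \<open>The weighted sum depends only on the totals \<open>s l\<close> of \<open>m\<close> over
  the elements of weight \<open>l\<close>, so the functions are classified by these totals. For the
  theorem, \<open>P\<close> is the set of cycles and \<open>w\<close> is
  \<open>card\<close>.\<close>

lemma card_PiE_weighted_sum_eq:
  assumes "finite P" and "w ` P \<subseteq> {1..n}"
  shows "card {m \<in> P \<rightarrow>\<^sub>E UNIV. (\<Sum>x\<in>P. w x * m x) = k} =
    (\<Sum>s\<in>weighted_sequences n k. \<Prod>l=1..n.
       card {f \<in> {x \<in> P. w x = l} \<rightarrow>\<^sub>E UNIV. sum f {x \<in> P. w x = l} = s l})"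
proof -
  let ?B = "\<lambda>s. {m \<in> P \<rightarrow>\<^sub>E (UNIV :: nat set). \<forall>l\<in>{1..n}. sum m {x \<in> P. w x = l} = s l}"
  let ?M = "{m \<in> P \<rightarrow>\<^sub>E UNIV. (\<Sum>x\<in>P. w x * m x) = k}"
  have total: "(\<Sum>l=1..n. l * sum m {x \<in> P. w x = l}) = (\<Sum>x\<in>P. w x * m x)" for m
  proof -
    have "(\<Sum>l=1..n. l * sum m {x \<in> P. w x = l}) = (\<Sum>l=1..n. \<Sum>x\<in>{x \<in> P. w x = l}. w x * m x)"
      by (simp add: sum_distrib_left)
    also have "\<dots> = (\<Sum>x\<in>P. w x * m x)"
      using assms by (intro sum.group) auto
    finally show ?thesis .
  qed
  \<comment> \<open>Weights are at least 1, so every value of \<open>m\<close> is bounded by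
    \<open>k\<close>.\<close>
  have fin: "finite ?M"
  proof (rule finite_subset)
    show "?M \<subseteq> P \<rightarrow>\<^sub>E {..k}"
    proof
      fix m assume m: "m \<in> ?M"
      have "m x \<le> k" if x: "x \<in> P" for x
      proof -
        have "m x \<le> w x * m x" using x assms(2) by auto
        also have "\<dots> \<le> (\<Sum>x\<in>P. w x * m x)"
          using x assms(1) by (intro member_le_sum) auto
        finally show ?thesis using m by simp
      qed
      then show "m \<in> P \<rightarrow>\<^sub>E {..k}" using m by (auto simp: PiE_iff)
    qed
  qed (simp add: assms(1) finite_PiE)
  have B_sub: "?B s \<subseteq> ?M" if "s \<in> weighted_sequences n k" for s
    using that by (auto simp: weighted_sequences_def total[symmetric])
  have "?M = (\<Union>s\<in>weighted_sequences n k. ?B s)"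
  proof
    show "?M \<subseteq> (\<Union>s\<in>weighted_sequences n k. ?B s)"
    proof
      fix m assume m: "m \<in> ?M"
      then have "(\<lambda>l\<in>{1..n}. sum m {x \<in> P. w x = l}) \<in> weighted_sequences n k"
        using total[of m] by (simp add: weighted_sequences_def)
      then show "m \<in> (\<Union>s\<in>weighted_sequences n k. ?B s)"
        using m by (intro UN_I) auto
    qed
  qed (use B_sub in blast)
  also have "card \<dots> = (\<Sum>s\<in>weighted_sequences n k. card (?B s))"
  proof (rule card_UN_disjoint)
    show "\<forall>s\<in>weighted_sequences n k. \<forall>t\<in>weighted_sequences n k. s \<noteq> t \<longrightarrow> ?B s \<inter> ?B t = {}"
    proof (intro ballI impI)
      fix s t assume "s \<in> weighted_sequences n k" "t \<in> weighted_sequences n k" "s \<noteq> t"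
      \<comment> \<open>Both sequences are extensional, so they already differ at an index in
        \<open>{1..n}\<close>, where \<open>m\<close> cannot have both totals.\<close>
      then obtain l where "l \<in> {1..n}" "s l \<noteq> t l"
        unfolding weighted_sequences_def by (metis (no_types, lifting) PiE_ext mem_Collect_eq)
      then show "?B s \<inter> ?B t = {}" by force
    qed
    show "\<forall>s\<in>weighted_sequences n k. finite (?B s)"
      by (intro ballI finite_subset[OF B_sub fin])
  qed (rule finite_weighted_sequences)
  finally show ?thesis
    using assms by (simp only: card_PiE_fibre_sums finite_atLeastAtMost)
qed

section \<open>Cycles and fixed multisets of a permutation\<close>

lemma permutes_orbit_step:
  assumes "\<sigma> permutes A" and "finite A"
  shows "orbit \<sigma> (\<sigma> x) = orbit \<sigma> x"
  using permutation_orbit_step[of \<sigma> x] assms permutation_permutes by blast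

lemma permutes_self_in_orbit:
  assumes "\<sigma> permutes A" and "finite A"
  shows "x \<in> orbit \<sigma> x"
  using permutation_self_in_orbit[of \<sigma> x] assms permutation_permutes by blast

lemma permutes_orbit_eq:
  assumes "\<sigma> permutes A" and "finite A" and "y \<in> orbit \<sigma> x"
  shows "orbit \<sigma> y = orbit \<sigma> x"
  using assms(3) by induction (simp_all add: permutes_orbit_step[OF assms(1,2)])

lemma count_image_mset_permutes:
  assumes "\<sigma> permutes A"
  shows "count (image_mset \<sigma> M) (\<sigma> x) = count M x"
  using permutes_inj[OF assms] by (induction M) (auto simp: inj_eq)

text \<open>By surjectivity every point has the form \<open>\<sigma> x\<close>, and there the image
  has multiplicity \<open>count M x\<close>.\<close>

lemma image_mset_eq_iff_count:
  assumes "\<sigma> permutes A"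
  shows "image_mset \<sigma> M = M \<longleftrightarrow> (\<forall>x. count M (\<sigma> x) = count M x)"
  using permutes_surj[OF assms]
  by (metis count_image_mset_permutes[OF assms] multiset_eqI surjD)

text \<open>A fixed tuple has constant multiplicity on each cycle, so it can be read off at one
  representative, for which \<open>Min C\<close> is chosen. A cycle \<open>C\<close> contributes
  \<open>card C * m C\<close> entries to the length.\<close>

lemma bij_betw_fixed_points_cycle_multiplicities:
  assumes "\<sigma> permutes {1..n}"
  defines "P \<equiv> orbit \<sigma> ` {1..n}"
  shows "bij_betw (\<lambda>xs. \<lambda>C\<in>P. count (mset xs) (Min C))
    {xs \<in> weakly_increasing_tuples n k. sym_tensor_power n k \<sigma> xs = xs}
    {m \<in> P \<rightarrow>\<^sub>E UNIV. (\<Sum>C\<in>P. card C * m C) = k}"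
proof -
  let ?X = "{xs \<in> weakly_increasing_tuples n k. sym_tensor_power n k \<sigma> xs = xs}"
  let ?Y = "{m \<in> P \<rightarrow>\<^sub>E UNIV. (\<Sum>C\<in>P. card C * m C) = k}"
  let ?f = "\<lambda>xs. \<lambda>C\<in>P. count (mset xs) (Min C)"
  \<comment> \<open>\<open>M m\<close> contains every element of the cycle \<open>C\<close> exactly
    \<open>m C\<close> times; sorting it yields the inverse map.\<close>
  define M where "M m = (\<Sum>C\<in>P. repeat_mset (m C) (mset_set C))" for m :: "nat set \<Rightarrow> nat"
  have finP: "finite P" by (simp add: P_def)
  have sub: "C \<subseteq> {1..n}" if "C \<in> P" for C
    using that permutes_orbit_subset[OF assms(1)] unfolding P_def by blast
  have finC: "finite C" if "C \<in> P" for C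
    using sub[OF that] finite_subset by blast
  have ne: "C \<noteq> {}" if "C \<in> P" for C
    using that by (auto simp: P_def orbit_nonempty)
  have orb: "orbit \<sigma> x = C" if "C \<in> P" "x \<in> C" for x C
    using that permutes_orbit_eq[OF assms(1)] by (auto simp: P_def)
  have self: "x \<in> orbit \<sigma> x" for x
    using permutes_self_in_orbit[OF assms(1)] by simp
  have Min: "Min C \<in> C" if "C \<in> P" for C
    using finC ne that by simp
  have count_M: "count (M m) x = (if x \<in> {1..n} then m (orbit \<sigma> x) else 0)" for m x
  proof -
    have "count (M m) x = (\<Sum>C\<in>P. if x \<in> C then m C else 0)"
      unfolding M_def count_sum using finC by (intro sum.cong) auto
    \<comment> \<open>Only the orbit of \<open>x\<close> can contain \<open>x\<close>, so the sum
      collapses to one term; the inner \<open>if\<close> handles points outside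
      \<open>{1..n}\<close>.\<close>
    also have "\<dots> = (\<Sum>C\<in>P. if C = orbit \<sigma> x then (if x \<in> {1..n} then m C else 0) else 0)"
    proof (rule sum.cong[OF refl])
      fix C assume C: "C \<in> P"
      then have "x \<in> C \<longleftrightarrow> C = orbit \<sigma> x" using orb self by blast
      moreover have "x \<in> C \<Longrightarrow> x \<in> {1..n}" using sub[OF C] by blast
      ultimately show "(if x \<in> C then m C else 0) =
          (if C = orbit \<sigma> x then (if x \<in> {1..n} then m C else 0) else 0)"
        by metis
    qed
    also have "\<dots> = (if x \<in> {1..n} then m (orbit \<sigma> x) else 0)"
      using finP by (auto simp: P_def)
    finally show ?thesis .
  qed
  have size_M: "size (M m) = (\<Sum>C\<in>P. card C * m C)" for m
    by (simp add: M_def mult.commute)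
  have fixed: "xs \<in> ?X \<longleftrightarrow> sorted xs \<and> length xs = k \<and> set xs \<subseteq> {1..n} \<and>
      (\<forall>x. count (mset xs) (\<sigma> x) = count (mset xs) x)" for xs
  proof -
    \<comment> \<open>A sorted list is the sort of any list with the same multiset.\<close>
    have "sort (map \<sigma> xs) = xs \<longleftrightarrow> image_mset \<sigma> (mset xs) = mset xs" if "sorted xs"
      using that by (metis mset_map mset_sort properties_for_sort)
    then show ?thesis
      by (auto simp: weakly_increasing_tuples_def sym_tensor_power_def
          image_mset_eq_iff_count[OF assms(1)])
  qed
  have M_f: "M (?f xs) = mset xs" if "xs \<in> ?X" for xs
  proof (rule multiset_eqI)
    fix x
    have inv: "count (mset xs) (\<sigma> y) = count (mset xs) y" for y
      using that fixed by blast
    \<comment> \<open>Invariance under \<open>\<sigma>\<close> propagates along the orbit; the case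
      needed is \<open>y = Min (orbit \<sigma> x)\<close>.\<close>
    have const: "count (mset xs) y = count (mset xs) x" if "y \<in> orbit \<sigma> x" for y
      using that by induction (simp_all add: inv)
    show "count (M (?f xs)) x = count (mset xs) x"
    proof (cases "x \<in> {1..n}")
      case True
      then have "orbit \<sigma> x \<in> P" by (simp add: P_def)
      then show ?thesis using True const Min by (simp add: count_M)
    next
      case False
      then have "count (mset xs) x = 0" using that fixed by auto
      then show ?thesis using False unfolding count_M by auto
    qed
  qed
  show ?thesis
  proof (rule bij_betw_byWitness[where f' = "\<lambda>m. sorted_list_of_multiset (M m)"])
    show "\<forall>xs\<in>?X. sorted_list_of_multiset (M (?f xs)) = xs"
    proof
      fix xs assume xs: "xs \<in> ?X"
      then have "sorted xs" using fixed by blast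
      then show "sorted_list_of_multiset (M (?f xs)) = xs"
        unfolding M_f[OF xs] by (simp add: sorted_sort_id)
    qed
    show "\<forall>m\<in>?Y. ?f (sorted_list_of_multiset (M m)) = m"
    proof
      fix m assume "m \<in> ?Y"
      moreover have "count (M m) (Min C) = m C" if "C \<in> P" for C
      proof -
        have "Min C \<in> {1..n}" "orbit \<sigma> (Min C) = C"
          using that Min orb sub by blast+
        then show ?thesis by (simp add: count_M)
      qed
      ultimately show "?f (sorted_list_of_multiset (M m)) = m"
        by (auto simp: fun_eq_iff PiE_iff extensional_def)
    qed
    show "?f ` ?X \<subseteq> ?Y"
    proof (intro image_subsetI)
      fix xs assume xs: "xs \<in> ?X"
      then have "length xs = k" using fixed by blast
      then have "(\<Sum>C\<in>P. card C * ?f xs C) = k"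
        unfolding size_M[symmetric] M_f[OF xs] by simp
      then show "?f xs \<in> ?Y" by auto
    qed
    show "(\<lambda>m. sorted_list_of_multiset (M m)) ` ?Y \<subseteq> ?X"
    proof (intro image_subsetI)
      fix m assume m: "m \<in> ?Y"
      have "length (sorted_list_of_multiset (M m)) = k"
        using m size_M[of m] size_mset[of "sorted_list_of_multiset (M m)"] by simp
      moreover have "set_mset (M m) \<subseteq> {1..n}"
        using count_M[of m] by (metis not_in_iff subsetI)
      moreover have "count (M m) (\<sigma> x) = count (M m) x" for x
        using permutes_in_image[OF assms(1), of x]
        by (simp add: count_M permutes_orbit_step[OF assms(1)])
      ultimately show "sorted_list_of_multiset (M m) \<in> ?X"
        by (subst fixed) simp
    qed
  qed
qed

theorem theorem3p6:
  fixes n k :: nat and \<sigma> :: "nat \<Rightarrow> nat" and c :: "nat \<Rightarrow> nat"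
  assumes "n \<ge> 1" and "k \<ge> 1"
    and "\<sigma> permutes {1..n}"
    and "\<And>l. l \<in> {1..n} \<Longrightarrow> c l = num_cycles {1..n} \<sigma> l"
  shows "real (num_fixed_points (weakly_increasing_tuples n k) (sym_tensor_power n k \<sigma>)) =
    (\<Sum>s \<in> weighted_sequences n k.
       \<Prod>l=1..n. (real (s l) + real (c l) - 1) gchoose s l)"
proof -
  define P where "P = orbit \<sigma> ` {1..n}"
  have finP: "finite P" by (simp add: P_def)
  have len: "card ` P \<subseteq> {1..n}"
  proof (intro image_subsetI)
    fix C assume C: "C \<in> P"
    then have sub: "C \<subseteq> {1..n}"
      using permutes_orbit_subset[OF assms(3)] unfolding P_def by blast
    have "C \<noteq> {}"
      using C by (auto simp: P_def orbit_nonempty)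
    then have "card C > 0"
      using finite_subset[OF sub] by (simp add: card_gt_0_iff)
    then show "card C \<in> {1..n}"
      using card_mono[OF _ sub] by simp
  qed
  have "num_fixed_points (weakly_increasing_tuples n k) (sym_tensor_power n k \<sigma>) =
      card {m \<in> P \<rightarrow>\<^sub>E UNIV. (\<Sum>C\<in>P. card C * m C) = k}"
    unfolding num_fixed_points_def P_def
    using bij_betw_fixed_points_cycle_multiplicities[OF assms(3)] by (rule bij_betw_same_card)
  \<comment> \<open>The fibre of \<open>card\<close> over \<open>l\<close> consists of the cycles of
    length \<open>l\<close>, so stars and bars on it gives the factor for \<open>l\<close>.\<close>
  moreover have "card {C \<in> P. card C = l} = c l" if "l \<in> {1..n}" for l
    using assms(4)[OF that] by (simp add: num_cycles_def P_def)
  ultimately show ?thesis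
    using finP len by (simp add: card_PiE_weighted_sum_eq card_PiE_sum_eq_gbinomial)
qed

end
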